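(* Let $M_j$ ($j\in\mathbb N$) be precompact open metric spaces and $(X,d_X)$ a compact metric space such that $(\bar M_j,d_{M_j})\to(X,d_X)$ in the Gromov-Hausdorff sense. (1) For each $\delta>0$ there exist a subsequence $\{j_k\}$ and a compact metric space $Y^\delta(j_k)\subset X$ (with the restricted metric $d_\delta$) such that $$(\bar M_{j_k}^\delta,d_{M_{j_k}})\to (Y^\delta(j_k),d_\delta)\quad\text{in the Gromov-Hausdorff sense.}\qquad( * )$$ Moreover, given a sequence of positive numbers $\delta_i\to0$, there is a subsequence $\{j_k\}$ such that $( * )$ holds, with compact subsets $Y^{\delta_i}(j_k)\subset X$, for all $\delta=\delta_i$. (2) For a subsequence $\{j_k\}$, the subsets $Y^\delta(j_k)\subset X$, for the $\delta>0$ for which $( * )$ holds, can be chosen so that the following hold: (a) if $( * )$ holds for $\delta_1$ and $\delta_2$ with $0<\delta_2<\delta_1$, then $Y^{\delta_1}(j_k)\subset Y^{\delta_2}(j_k)$; (b) if $\delta_i\to 0$ are positive numbers such that $( * )$ holds for all $\delta=\delta_i$, then $U_{\{\delta_i\},\{j_k\}}=\bigcup_{i}Y^{\delta_i}(j_k)$ is an open subset of $X$; (c) if $\{\delta_i\}$ and $\{\beta_i\}$ are two sequences of positive numbers converging to $0$ such that $( * )$ holds for all $\delta\in\{\delta_i\}\cup\{\beta_i\}$, then $U_{\{\delta_i\},\{j_k\}}=U_{\{\beta_i\},\{j_k\}}$.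
   Context: For a metric space $(M,d_M)$, $\bar M$ is its metric completion and $\partial M:=\bar M\setminus M$. $M$ is called open if it is open in $\bar M$ (so $d_M(x,\partial M)>0$ for all $x\in M$). For $\delta>0$, $M^\delta=\{x\in M: d_M(x,\partial M)>\delta\}$ ($M^\delta=M$ if $\partial M=\emptyset$), and $\bar M^\delta$ is the metric completion of $(M^\delta,d_M)$ with the restricted metric $d_M$. $M^\delta$ may be empty; the Gromov-Hausdorff limit of empty metric spaces is taken to be the empty metric space. *)

theory Defs
  imports "HOL-Analysis.Analysis"
begin

section \<open>Metric completion\<close>

definition isometric_embedding :: "'a metric \<Rightarrow> 'b metric \<Rightarrow> ('a \<Rightarrow> 'b) \<Rightarrow> bool" where
  "isometric_embedding A Z f \<longleftrightarrow>
     f \<in> mspace A \<rightarrow> mspace Z \<and>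
     (\<forall>x\<in>mspace A. \<forall>y\<in>mspace A. mdist Z (f x) (f y) = mdist A x y)"

definition is_completion :: "'a metric \<Rightarrow> ('a \<Rightarrow> 'b) \<Rightarrow> 'b metric \<Rightarrow> bool" where
  "is_completion M \<iota> N \<longleftrightarrow>
     mcomplete_of N \<and> isometric_embedding M N \<iota> \<and>
     mtopology_of N closure_of (\<iota> ` mspace M) = mspace N"

text \<open>The completion is unique up to isometry, so we fix one together with the embedding.
  By the library's existence theorem one can be found on the type \<open>'a \<Rightarrow> real\<close>
  (see \<open>is_completion_mcompletion\<close>).\<close>

definition completion_pair :: "'a metric \<Rightarrow> ('a \<Rightarrow> ('a \<Rightarrow> real)) \<times> ('a \<Rightarrow> real) metric" where
  "completion_pair M = (SOME (\<iota>, N). is_completion M \<iota> N)"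

definition to_completion :: "'a metric \<Rightarrow> 'a \<Rightarrow> ('a \<Rightarrow> real)" where
  "to_completion M = fst (completion_pair M)"

definition mcompletion :: "'a metric \<Rightarrow> ('a \<Rightarrow> real) metric" where
  "mcompletion M = snd (completion_pair M)"

lemma is_completion_mcompletion:
  fixes M :: "'a metric"
  shows "is_completion M (to_completion M) (mcompletion M)"
proof -
  interpret Metric_space "mspace M" "mdist M" by simp
  obtain f :: "'a \<Rightarrow> 'a \<Rightarrow> real" and N where
    "mcomplete_of N" "f \<in> mspace M \<rightarrow> mspace N"
    "mtopology_of N closure_of f ` mspace M = mspace N"
    "\<And>x y. \<lbrakk>x \<in> mspace M; y \<in> mspace M\<rbrakk> \<Longrightarrow> mdist N (f x) (f y) = mdist M x y"
    by (rule metric_completion) (rule that)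
  then have "is_completion M f N"
    by (simp add: is_completion_def isometric_embedding_def)
  then have "case (f, N) of (\<iota>, N) \<Rightarrow> is_completion M \<iota> N" by simp
  from someI[of "\<lambda>(\<iota>, N). is_completion M \<iota> N", OF this] show ?thesis
    by (simp add: to_completion_def mcompletion_def completion_pair_def case_prod_beta)
qed

section \<open>Boundary, open and precompact metric spaces, and the inner regions\<close>

definition mboundary :: "'a metric \<Rightarrow> ('a \<Rightarrow> real) set" where
  "mboundary M = mspace (mcompletion M) - to_completion M ` mspace M"

definition open_metric :: "'a metric \<Rightarrow> bool" where
  "open_metric M \<longleftrightarrow> openin (mtopology_of (mcompletion M)) (to_completion M ` mspace M)"

definition precompact_metric :: "'a metric \<Rightarrow> bool" where
  "precompact_metric M \<longleftrightarrow> compact_space (mtopology_of (mcompletion M))"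

text \<open>Valued in \<^typ>\<open>ennreal\<close>, so the distance to an empty boundary is \<open>\<top>\<close>.\<close>

definition boundary_dist :: "'a metric \<Rightarrow> 'a \<Rightarrow> ennreal" where
  "boundary_dist M x = (INF p\<in>mboundary M. ennreal (mdist (mcompletion M) (to_completion M x) p))"

definition inner_region :: "'a metric \<Rightarrow> real \<Rightarrow> 'a metric" where
  "inner_region M \<delta> = submetric M {x \<in> mspace M. boundary_dist M x > ennreal \<delta>}"

lemma inner_region_no_boundary:
  "mboundary M = {} \<Longrightarrow> inner_region M \<delta> = M"
  by (simp add: inner_region_def boundary_dist_def)

section \<open>Gromov-Hausdorff convergence\<close>

text \<open>Infinite when exactly one of the two sets is empty, and zero when both are.\<close>

definition hausdorff_dist :: "'c metric \<Rightarrow> 'c set \<Rightarrow> 'c set \<Rightarrow> ennreal" where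
  "hausdorff_dist Z A B =
     Inf {ennreal e | e. e > 0 \<and> A \<subseteq> (\<Union>b\<in>B. mball_of Z b e) \<and> B \<subseteq> (\<Union>a\<in>A. mball_of Z a e)}"

text \<open>The infimum runs over common ambient spaces carried by subsets of \<open>'a + 'b\<close>. This is no
  restriction: an ambient space may be replaced by the union of the two images, and
  \<open>GH_dist_le\<close> shows that ambient spaces on any other type do not lower the infimum.\<close>

definition GH_dist :: "'a metric \<Rightarrow> 'b metric \<Rightarrow> ennreal" where
  "GH_dist A B =
     Inf {hausdorff_dist Z (f ` mspace A) (g ` mspace B) | (Z :: ('a + 'b) metric) f g.
            isometric_embedding A Z f \<and> isometric_embedding B Z g}"

lemma hausdorff_dist_isometric_image_le:
  assumes h: "isometric_embedding Z Z' h" and "A \<subseteq> mspace Z" "B \<subseteq> mspace Z"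
  shows "hausdorff_dist Z' (h ` A) (h ` B) \<le> hausdorff_dist Z A B"
proof -
  have *: "h ` S \<subseteq> (\<Union>b\<in>h ` T. mball_of Z' b e)"
    if "S \<subseteq> (\<Union>b\<in>T. mball_of Z b e)" "S \<subseteq> mspace Z" "T \<subseteq> mspace Z" for S T e
    using that h unfolding isometric_embedding_def by (fastforce simp: Pi_iff)
  show ?thesis
    unfolding hausdorff_dist_def
  proof (rule Inf_superset_mono, safe)
    fix e :: real
    assume "0 < e" "A \<subseteq> (\<Union>b\<in>B. mball_of Z b e)" "B \<subseteq> (\<Union>a\<in>A. mball_of Z a e)"
    then show "\<exists>e'. ennreal e = ennreal e' \<and> 0 < e' \<and>
        h ` A \<subseteq> (\<Union>b\<in>h ` B. mball_of Z' b e') \<and> h ` B \<subseteq> (\<Union>a\<in>h ` A. mball_of Z' a e')"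
      using assms by (intro exI[of _ e] conjI * refl)
  qed
qed

lemma GH_dist_le:
  fixes Z :: "'c metric" and A :: "'a metric" and B :: "'b metric"
  assumes f: "isometric_embedding A Z f" and g: "isometric_embedding B Z g"
  shows "GH_dist A B \<le> hausdorff_dist Z (f ` mspace A) (g ` mspace B)"
proof -
  define S where "S = f ` mspace A \<union> g ` mspace B"
  have SZ: "S \<subseteq> mspace Z"
    using f g by (auto simp: S_def isometric_embedding_def)
  define h :: "'c \<Rightarrow> 'a + 'b" where
    "h z = (if z \<in> f ` mspace A then Inl (inv_into (mspace A) f z)
            else Inr (inv_into (mspace B) g z))" for z
  define k :: "'a + 'b \<Rightarrow> 'c" where "k = case_sum f g"
  have kh: "k (h z) = z" if "z \<in> S" for z
    using that by (auto simp: S_def h_def k_def f_inv_into_f)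
  interpret Z: Metric_space "mspace Z" "mdist Z" by simp
  have "Metric_space (h ` S) (\<lambda>u v. mdist Z (k u) (k v))"
    unfolding Metric_space_def using SZ
    by (auto simp: kh mdist_commute subset_iff intro: mdist_triangle)
  then interpret W: Metric_space "h ` S" "\<lambda>u v. mdist Z (k u) (k v)" .
  define W where "W = metric (h ` S, \<lambda>u v. mdist Z (k u) (k v))"
  have h: "isometric_embedding (submetric Z S) W h"
    using SZ by (auto simp: isometric_embedding_def W_def kh)
  have "isometric_embedding A W (h \<circ> f)" "isometric_embedding B W (h \<circ> g)"
    using h f g SZ unfolding isometric_embedding_def S_def by (auto simp: Pi_iff)
  then have "GH_dist A B \<le> hausdorff_dist W ((h \<circ> f) ` mspace A) ((h \<circ> g) ` mspace B)"
    unfolding GH_dist_def by (intro Inf_lower) blast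
  also have "\<dots> \<le> hausdorff_dist (submetric Z S) (f ` mspace A) (g ` mspace B)"
    unfolding image_comp[symmetric]
    using SZ by (intro hausdorff_dist_isometric_image_le[OF h]) (auto simp: S_def)
  also have "\<dots> = hausdorff_dist Z (f ` mspace A) (g ` mspace B)"
  proof -
    have "U \<subseteq> (\<Union>b\<in>V. mball_of (submetric Z S) b e) \<longleftrightarrow> U \<subseteq> (\<Union>b\<in>V. mball_of Z b e)"
      if "U \<subseteq> S" "V \<subseteq> S" for U V e
      using that SZ by (auto simp: subset_iff)
    note this[of "f ` mspace A" "g ` mspace B"] this[of "g ` mspace B" "f ` mspace A"]
    then show ?thesis unfolding hausdorff_dist_def S_def by simp
  qed
  finally show ?thesis .
qed

definition GH_converges :: "(nat \<Rightarrow> 'a metric) \<Rightarrow> 'b metric \<Rightarrow> bool" where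
  "GH_converges S L \<longleftrightarrow> (\<lambda>j. GH_dist (S j) L) \<longlonglongrightarrow> 0"

text \<open>\<open>inner_limit M X j \<delta> Y\<close>: the set \<open>Y\<close> is a compact subset of \<open>X\<close>, and with the restricted
  metric it is the limit of the completed inner \<open>\<delta>\<close>-regions along the subsequence \<open>j\<close>.\<close>

definition inner_limit ::
  "(nat \<Rightarrow> 'a metric) \<Rightarrow> 'b metric \<Rightarrow> (nat \<Rightarrow> nat) \<Rightarrow> real \<Rightarrow> 'b set \<Rightarrow> bool" where
  "inner_limit M X j \<delta> Y \<longleftrightarrow>
     compactin (mtopology_of X) Y \<and>
     GH_converges (\<lambda>k. mcompletion (inner_region (M (j k)) \<delta>)) (submetric X Y)"

definition has_inner_limit ::
  "(nat \<Rightarrow> 'a metric) \<Rightarrow> 'b metric \<Rightarrow> (nat \<Rightarrow> nat) \<Rightarrow> real \<Rightarrow> bool" where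
  "has_inner_limit M X j \<delta> \<longleftrightarrow> (\<exists>Y. inner_limit M X j \<delta> Y)"

definition positive_null_seq :: "(nat \<Rightarrow> real) \<Rightarrow> bool" where
  "positive_null_seq \<delta> \<longleftrightarrow> (\<forall>i. \<delta> i > 0) \<and> \<delta> \<longlonglongrightarrow> 0"

end

theory Submission
  imports Defs
begin

text \<open>
  The limit sets are taken along one nonprincipal ultrafilter \<open>U\<close> on the index set instead of
  along further subsequences. This is what makes part (2) possible in one stroke: the parameters
  \<open>\<delta>\<close> for which the completed inner regions converge may be uncountably many, out of reach of
  a diagonal choice of subsequences, but every sequence in a compact space converges along \<open>U\<close>.

  Gromov-Hausdorff closeness of the completion of \<open>M\<^sub>k\<close> and \<open>X\<close> is expressed by a
  correspondence \<open>R\<^sub>k\<close> whose distortion tends to \<open>0\<close>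
  (\<open>GH_converges_correspondences\<close>). Let \<open>S\<^sub>k\<close> be the part of \<open>X\<close> that \<open>R\<^sub>k\<close> relates to the
  inner region of \<open>M\<^sub>k\<close>, and let \<open>Y \<delta>\<close> be the set of points of \<open>X\<close> that are approached by the
  sets \<open>S\<^sub>k\<close> along \<open>U\<close>. By compactness of \<open>X\<close>, the sets \<open>S\<^sub>k\<close> converge to \<open>Y \<delta>\<close> in the Hausdorff
  sense along \<open>U\<close> (\<open>eventually_near_limit_set\<close>, \<open>eventually_limit_set_near\<close>), so the inner
  regions converge to \<open>Y \<delta>\<close> in the Gromov-Hausdorff sense along \<open>U\<close>; passing to their completions
  does not change any Gromov-Hausdorff distance.

  Part (1): for countably many \<open>\<delta>\<close>, the members of \<open>U\<close> on which finitely many of the distances are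
  small are infinite sets, and a diagonal choice from them yields the subsequence
  (\<open>diagonal_subsequence_of_ultralimits\<close>).

  Part (2): if the inner regions converge at all, then the triangle inequality for the
  Gromov-Hausdorff distance puts their limit at distance \<open>0\<close> from \<open>Y \<delta>\<close>, so the whole sequence
  converges to \<open>Y \<delta>\<close> (\<open>GH_converges_if_subconverges\<close>). The family \<open>Y\<close> is antitone because the
  inner regions are, and this gives (a) and (c). For (b), the distance to the boundary is
  1-Lipschitz: a point of \<open>X\<close> closer than \<open>\<delta>/2\<close> to \<open>Y \<delta>\<close> corresponds to points of the completions
  that stay at distance more than \<open>\<delta>/4\<close> from the boundary, hence it lies in \<open>Y (\<delta>/4)\<close>.
\<close>

section \<open>Ultrafilters and limits in compact spaces\<close>

definition is_ultrafilter :: "'a filter \<Rightarrow> bool" where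
  "is_ultrafilter U \<longleftrightarrow> U \<noteq> bot \<and> (\<forall>P. eventually P U \<or> eventually (\<lambda>x. \<not> P x) U)"

lemma ultrafilter_not_eventually:
  assumes "is_ultrafilter U" "\<not> eventually P U"
  shows "eventually (\<lambda>x. \<not> P x) U"
  using assms unfolding is_ultrafilter_def by blast

text \<open>Zorn's lemma applied to the proper filters below \<open>F\<close>, ordered so that finer filters
  are larger: a chain has its infimum as a bound, and a maximal element that decided neither \<open>P\<close> nor
  its negation could be refined by \<open>P\<close>.\<close>

lemma ex_ultrafilter_le:
  assumes "F \<noteq> bot"
  shows "\<exists>U. is_ultrafilter U \<and> U \<le> F"
proof -
  define \<A> where "\<A> = {G. G \<noteq> bot \<and> G \<le> F}"
  have po: "partial_order_on \<A> (relation_of (\<lambda>G H. H \<le> G) \<A>)"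
    by (rule partial_order_on_relation_ofI) auto
  have ub: "\<exists>u\<in>\<A>. \<forall>G\<in>C. u \<le> G" if C: "C \<in> Chains (relation_of (\<lambda>G H. H \<le> G) \<A>)" for C
  proof (cases "C = {}")
    case True
    then show ?thesis using assms by (auto simp: \<A>_def)
  next
    case False
    have sub: "C \<subseteq> \<A>" and ch: "\<And>G H. G \<in> C \<Longrightarrow> H \<in> C \<Longrightarrow> G \<le> H \<or> H \<le> G"
      using C by (auto simp: Chains_def relation_of_def)
    have "eventually (\<lambda>_. False) (Inf C) \<longleftrightarrow> (\<exists>G\<in>C. eventually (\<lambda>_. False) G)"
    proof (rule eventually_Inf_base[OF False])
      show "\<exists>K\<in>C. K \<le> inf G H" if "G \<in> C" "H \<in> C" for G H
        using ch[OF that]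
      proof
        assume "G \<le> H"
        then show ?thesis using that(1) by (intro bexI[of _ G]) auto
      next
        assume "H \<le> G"
        then show ?thesis using that(2) by (intro bexI[of _ H]) auto
      qed
    qed
    moreover have "\<not> eventually (\<lambda>_. False) G" if "G \<in> C" for G
      using that sub by (auto simp: \<A>_def trivial_limit_def)
    ultimately have "Inf C \<noteq> bot" by (auto simp: trivial_limit_def)
    moreover have "Inf C \<le> F"
      using False sub by (auto simp: \<A>_def intro: Inf_lower2)
    ultimately have "Inf C \<in> \<A>" by (simp add: \<A>_def)
    then show ?thesis by (intro bexI[of _ "Inf C"]) (auto intro: Inf_lower)
  qed
  have "\<exists>U\<in>\<A>. \<forall>G\<in>\<A>. G \<le> U \<longrightarrow> G = U"
    by (rule predicate_Zorn[OF po ub])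
  then obtain U where
    U: "U \<in> \<A>" and maxU: "\<And>G. G \<in> \<A> \<Longrightarrow> G \<le> U \<Longrightarrow> G = U" by auto
  have "eventually P U \<or> eventually (\<lambda>x. \<not> P x) U" for P
  proof (cases "inf U (principal {x. P x}) = bot")
    case True
    then have "eventually (\<lambda>_. False) (inf U (principal {x. P x}))" by simp
    then show ?thesis by (simp add: eventually_inf_principal)
  next
    case False
    then have "inf U (principal {x. P x}) \<in> \<A>"
      using U by (auto simp: \<A>_def intro: le_infI1)
    then have "U \<le> principal {x. P x}"
      using maxU[OF _ inf_le1] by (metis inf_le2)
    then show ?thesis by (simp add: le_principal)
  qed
  then show ?thesis using U by (auto simp: is_ultrafilter_def \<A>_def)
qed

text \<open>If no point were a limit, each would have a neighbourhood that \<open>f\<close> eventually avoids, because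
  \<open>U\<close> decides every predicate; finitely many of these cover the space, and then \<open>f\<close> eventually has
  no value left.\<close>

lemma compact_space_ultrafilter_limit:
  assumes U: "is_ultrafilter U" and T: "compact_space T" and f: "\<forall>\<^sub>F k in U. f k \<in> topspace T"
  shows "\<exists>l. limitin T f l U"
proof (rule ccontr)
  assume "\<nexists>l. limitin T f l U"
  then have "\<exists>W. openin T W \<and> l \<in> W \<and> \<not> (\<forall>\<^sub>F k in U. f k \<in> W)" if "l \<in> topspace T" for l
    using that by (auto simp: limitin_def)
  then obtain W where W: "\<And>l. l \<in> topspace T \<Longrightarrow>
      openin T (W l) \<and> l \<in> W l \<and> \<not> (\<forall>\<^sub>F k in U. f k \<in> W l)" by metis
  have "\<exists>\<F>. finite \<F> \<and> \<F> \<subseteq> W ` topspace T \<and> topspace T \<subseteq> \<Union>\<F>"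
  proof (rule T[unfolded compact_space_alt, rule_format], intro conjI ballI)
    show "openin T V" if "V \<in> W ` topspace T" for V
      using W that by blast
    show "topspace T \<subseteq> \<Union>(W ` topspace T)"
      using W by blast
  qed
  then obtain \<F> where \<F>: "finite \<F>" "\<F> \<subseteq> W ` topspace T" "topspace T \<subseteq> \<Union>\<F>" by blast
  have "\<forall>\<^sub>F k in U. \<forall>V\<in>\<F>. f k \<notin> V"
    using \<F> W ultrafilter_not_eventually[OF U] by (intro eventually_ball_finite) auto
  with f have "\<forall>\<^sub>F k in U. False"
    by eventually_elim (use \<F>(3) in auto)
  then show False using U by (simp add: is_ultrafilter_def)
qed

section \<open>Correspondences and the Gromov-Hausdorff distance\<close>

text \<open>The bound is \<open>2 * e\<close> rather than \<open>e\<close> so that \<open>e\<close> is comparable with the Gromov-Hausdorff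
  distance itself, which is half the infimum of the distortions of correspondences.\<close>

definition correspondence :: "'a metric \<Rightarrow> 'b metric \<Rightarrow> real \<Rightarrow> ('a \<times> 'b) set \<Rightarrow> bool" where
  "correspondence A B e R \<longleftrightarrow> Domain R = mspace A \<and> Range R = mspace B \<and>
     (\<forall>a b a' b'. (a, b) \<in> R \<longrightarrow> (a', b') \<in> R \<longrightarrow> \<bar>mdist A a a' - mdist B b b'\<bar> \<le> 2 * e)"

lemma correspondence_in_space:
  assumes "correspondence A B e R" "(a, b) \<in> R"
  shows "a \<in> mspace A" "b \<in> mspace B"
  using assms by (auto simp: correspondence_def)

lemma correspondence_total:
  assumes "correspondence A B e R"
  shows "a \<in> mspace A \<Longrightarrow> \<exists>b. (a, b) \<in> R" and "b \<in> mspace B \<Longrightarrow> \<exists>a. (a, b) \<in> R"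
proof -
  have "Domain R = mspace A" "Range R = mspace B"
    using assms by (simp_all add: correspondence_def)
  then show "a \<in> mspace A \<Longrightarrow> \<exists>b. (a, b) \<in> R" "b \<in> mspace B \<Longrightarrow> \<exists>a. (a, b) \<in> R"
    by blast+
qed

lemma correspondence_distortion:
  assumes "correspondence A B e R" "(a, b) \<in> R" "(a', b') \<in> R"
  shows "\<bar>mdist A a a' - mdist B b b'\<bar> \<le> 2 * e"
  using assms unfolding correspondence_def by blast

lemma correspondence_mono:
  assumes "correspondence A B e R" "e \<le> e'"
  shows "correspondence A B e' R"
  using assms unfolding correspondence_def by fastforce

lemma correspondence_converse:
  assumes "correspondence A B e R"
  shows "correspondence B A e (R\<inverse>)"
  using assms unfolding correspondence_def by (auto simp: abs_minus_commute)

lemma correspondence_comp: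
  assumes R: "correspondence A B e R" and S: "correspondence B C e' S"
  shows "correspondence A C (e + e') (R O S)"
proof -
  have "\<bar>mdist A a a' - mdist C c c'\<bar> \<le> 2 * (e + e')"
    if "(a, b) \<in> R" "(b, c) \<in> S" "(a', b') \<in> R" "(b', c') \<in> S" for a b c a' b' c'
    using correspondence_distortion[OF R that(1,3)] correspondence_distortion[OF S that(2,4)]
    by (simp add: abs_le_iff)
  moreover have "Domain (R O S) = mspace A" "Range (R O S) = mspace C"
  proof -
    have "Domain R = mspace A" "Range R = mspace B" "Domain S = mspace B" "Range S = mspace C"
      using R S by (simp_all add: correspondence_def)
    then show "Domain (R O S) = mspace A" "Range (R O S) = mspace C" by blast+
  qed
  ultimately show ?thesis unfolding correspondence_def by blast
qed

text \<open>In a common ambient space with Hausdorff distance below \<open>e\<close>, relate the points that are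
  closer than \<open>e\<close>.\<close>

lemma GH_dist_less_imp_correspondence:
  assumes "GH_dist A B < ennreal e"
  shows "\<exists>R. correspondence A B e R"
proof -
  from assms obtain Z :: "('a + 'b) metric" and f g where
    f: "isometric_embedding A Z f" and g: "isometric_embedding B Z g"
    and "hausdorff_dist Z (f ` mspace A) (g ` mspace B) < ennreal e"
    unfolding GH_dist_def by (auto simp: Inf_less_iff)
  then obtain r where r: "ennreal r < ennreal e" "r > 0"
    "f ` mspace A \<subseteq> (\<Union>b\<in>g ` mspace B. mball_of Z b r)"
    "g ` mspace B \<subseteq> (\<Union>a\<in>f ` mspace A. mball_of Z a r)"
    unfolding hausdorff_dist_def by (auto simp: Inf_less_iff)
  have re: "r < e" using r(1,2) by (simp add: ennreal_less_iff)
  define R where "R = {(a, b). a \<in> mspace A \<and> b \<in> mspace B \<and> mdist Z (f a) (g b) < r}"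
  have "\<bar>mdist A a a' - mdist B b b'\<bar> \<le> 2 * e" if "(a, b) \<in> R" "(a', b') \<in> R" for a b a' b'
  proof -
    interpret Z: Metric_space "mspace Z" "mdist Z" by simp
    have in_Z: "f a \<in> mspace Z" "f a' \<in> mspace Z" "g b \<in> mspace Z" "g b' \<in> mspace Z"
      and eqs: "mdist A a a' = mdist Z (f a) (f a')" "mdist B b b' = mdist Z (g b) (g b')"
      and less: "mdist Z (f a) (g b) < r" "mdist Z (f a') (g b') < r"
      using that f g by (auto simp: R_def isometric_embedding_def)
    have "mdist Z (f a) (f a') \<le> mdist Z (f a) (g b) + (mdist Z (g b) (g b') + mdist Z (g b') (f a'))"
      using Z.triangle[of "f a" "g b" "f a'"] Z.triangle[of "g b" "g b'" "f a'"] in_Z by linarith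
    moreover have "mdist Z (g b) (g b') \<le> mdist Z (g b) (f a) + (mdist Z (f a) (f a') + mdist Z (f a') (g b'))"
      using Z.triangle[of "g b" "f a" "g b'"] Z.triangle[of "f a" "f a'" "g b'"] in_Z by linarith
    ultimately show ?thesis
      using less re by (simp add: eqs Z.commute abs_le_iff)
  qed
  moreover have "Domain R = mspace A"
  proof -
    have "\<exists>b\<in>mspace B. mdist Z (f a) (g b) < r" if "a \<in> mspace A" for a
      using r(3) that by (fastforce simp: mdist_commute)
    then show ?thesis by (auto simp: R_def)
  qed
  moreover have "Range R = mspace B"
  proof -
    have "\<exists>a\<in>mspace A. mdist Z (f a) (g b) < r" if "b \<in> mspace B" for b
      using r(4) that by fastforce
    then show ?thesis by (auto simp: R_def)
  qed
  ultimately show ?thesis unfolding correspondence_def by blast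
qed

text \<open>The ambient space is the disjoint union in which related points are joined by an edge of
  length \<open>e\<close>; \<open>c a b\<close> is the resulting length of a shortest path from \<open>a\<close> to \<open>b\<close>. A path that
  crosses over and comes back uses two edges, and the distortion bound \<open>2 * e\<close> is exactly what keeps
  it from being a shortcut, so the metrics of \<open>A\<close> and \<open>B\<close> are preserved.\<close>

lemma correspondence_imp_GH_dist_le:
  fixes A :: "'a metric" and B :: "'b metric"
  assumes R: "correspondence A B e R" and e: "e > 0"
  shows "GH_dist A B \<le> ennreal e"
proof -
  interpret A: Metric_space "mspace A" "mdist A" by simp
  interpret B: Metric_space "mspace B" "mdist B" by simp
  \<comment> \<open>The first case only keeps \<open>c\<close> positive: an infimum over the empty set would be unspecified.\<close>
  define c where "c a b =
    (if R = {} then e else INF (a', b')\<in>R. mdist A a a' + e + mdist B b' b)" for a b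
  have low: "c a b \<le> mdist A a a' + e + mdist B b' b" if "(a', b') \<in> R" for a b a' b'
  proof -
    have "bdd_below ((\<lambda>(a', b'). mdist A a a' + e + mdist B b' b) ` R)"
      using e by (intro bdd_belowI2[of _ 0]) (auto intro!: add_nonneg_nonneg)
    moreover have "R \<noteq> {}" using that by auto
    ultimately show ?thesis
      unfolding c_def using cINF_lower[OF _ that, of "\<lambda>(a', b'). mdist A a a' + e + mdist B b' b"]
      by simp
  qed
  have great: "t \<le> c a b"
    if "a \<in> mspace A"
      "\<And>a' b'. (a', b') \<in> R \<Longrightarrow> t \<le> mdist A a a' + e + mdist B b' b" for t a b
  proof -
    have "R \<noteq> {}" using R that(1) by (auto simp: correspondence_def)
    then show ?thesis using that(2) by (auto simp: c_def intro!: cINF_greatest)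
  qed
  have c_ge: "e \<le> c a b" for a b
    unfolding c_def by (auto intro!: cINF_greatest)
  have c_le: "c a b \<le> e" if "(a, b) \<in> R" for a b
    using low[OF that, of a b] correspondence_in_space[OF R that] by simp
  have AAB: "c a b \<le> mdist A a a' + c a' b" if "a \<in> mspace A" "a' \<in> mspace A" for a a' b
  proof -
    have "c a b - mdist A a a' \<le> c a' b"
    proof (rule great[OF that(2)])
      fix x y assume xy: "(x, y) \<in> R"
      show "c a b - mdist A a a' \<le> mdist A a' x + e + mdist B y b"
        using low[OF xy, of a b] A.triangle[of a a' x] that correspondence_in_space[OF R xy] by linarith
    qed
    then show ?thesis by linarith
  qed
  have ABB: "c a b \<le> c a b' + mdist B b' b" if "a \<in> mspace A" "b \<in> mspace B" "b' \<in> mspace B" for a b b'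
  proof -
    have "c a b - mdist B b' b \<le> c a b'"
    proof (rule great[OF that(1)])
      fix x y assume xy: "(x, y) \<in> R"
      show "c a b - mdist B b' b \<le> mdist A a x + e + mdist B y b'"
        using low[OF xy, of a b] B.triangle[of y b' b] that correspondence_in_space[OF R xy] by linarith
    qed
    then show ?thesis by linarith
  qed
  have ABA: "mdist A a a' \<le> c a b + c a' b"
    if "a \<in> mspace A" "a' \<in> mspace A" "b \<in> mspace B" for a a' b
  proof -
    have "mdist A a a' - c a' b \<le> c a b"
    proof (rule great[OF that(1)])
      fix x y assume xy: "(x, y) \<in> R"
      have "mdist A a a' - (mdist A a x + e + mdist B y b) \<le> c a' b"
      proof (rule great[OF that(2)])
        fix x' y' assume xy': "(x', y') \<in> R"
        note inR = correspondence_in_space[OF R xy] correspondence_in_space[OF R xy']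
        show "mdist A a a' - (mdist A a x + e + mdist B y b) \<le> mdist A a' x' + e + mdist B y' b"
          using A.triangle[of a x a'] A.triangle[of x x' a'] A.commute[of a' x']
            B.triangle[of y b y'] B.commute[of b y'] that inR
            correspondence_distortion[OF R xy xy'] by linarith
      qed
      then show "mdist A a a' - c a' b \<le> mdist A a x + e + mdist B y b" by linarith
    qed
    then show ?thesis by linarith
  qed
  have BAB: "mdist B b b' \<le> c a b + c a b'"
    if "a \<in> mspace A" "b \<in> mspace B" "b' \<in> mspace B" for a b b'
  proof -
    have "mdist B b b' - c a b' \<le> c a b"
    proof (rule great[OF that(1)])
      fix x y assume xy: "(x, y) \<in> R"
      have "mdist B b b' - (mdist A a x + e + mdist B y b) \<le> c a b'"
      proof (rule great[OF that(1)])
        fix x' y' assume xy': "(x', y') \<in> R"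
        note inR = correspondence_in_space[OF R xy] correspondence_in_space[OF R xy']
        show "mdist B b b' - (mdist A a x + e + mdist B y b) \<le> mdist A a x' + e + mdist B y' b'"
          using B.triangle[of b y b'] B.triangle[of y y' b'] B.commute[of b y]
            A.triangle[of x a x'] A.commute[of x a] that inR
            correspondence_distortion[OF R xy xy'] by linarith
      qed
      then show "mdist B b b' - c a b' \<le> mdist A a x + e + mdist B y b" by linarith
    qed
    then show ?thesis by linarith
  qed
  define S where "S = Inl ` mspace A \<union> Inr ` mspace B"
  define d where "d u v = (case u of
      Inl a \<Rightarrow> (case v of Inl a' \<Rightarrow> mdist A a a' | Inr b \<Rightarrow> c a b)
    | Inr b \<Rightarrow> (case v of Inl a \<Rightarrow> c a b | Inr b' \<Rightarrow> mdist B b b'))" for u v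
  have dsimps [simp]: "d (Inl a) (Inl a') = mdist A a a'" "d (Inl a) (Inr b) = c a b"
    "d (Inr b) (Inl a) = c a b" "d (Inr b) (Inr b') = mdist B b b'" for a a' b b'
    by (simp_all add: d_def)
  have c_pos: "0 < c a b" for a b
    using c_ge[of a b] e by linarith
  have "Metric_space S d"
  proof
    show "0 \<le> d u v" for u v
      using c_pos by (cases u; cases v) (auto simp: less_imp_le)
    show "d u v = d v u" for u v
      by (cases u; cases v) (auto simp: mdist_commute)
    show "d u v = 0 \<longleftrightarrow> u = v" if "u \<in> S" "v \<in> S" for u v
      using that A.zero B.zero c_pos[THEN less_imp_neq] by (auto simp: S_def)
    show "d u w \<le> d u v + d v w" if "u \<in> S" "v \<in> S" "w \<in> S" for u v w
    proof -
      have "c a b \<le> c a' b + mdist A a' a" if "a \<in> mspace A" "a' \<in> mspace A" for a a' b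
        using AAB[OF that, of b] by (simp add: A.commute)
      moreover have "c a b \<le> c a b' + mdist B b b'"
        if "a \<in> mspace A" "b \<in> mspace B" "b' \<in> mspace B" for a b b'
        using ABB[OF that] by (simp add: B.commute)
      ultimately show ?thesis
        using that A.triangle B.triangle AAB ABB ABA BAB by (auto simp: S_def add.commute)
    qed
  qed
  then interpret Z: Metric_space S d .
  define Z where "Z = metric (S, d)"
  have Z: "mspace Z = S" "mdist Z = d" by (simp_all add: Z_def)
  have emb: "isometric_embedding A Z Inl" "isometric_embedding B Z Inr"
    using Z by (auto simp: isometric_embedding_def S_def)
  have "hausdorff_dist Z (Inl ` mspace A) (Inr ` mspace B) \<le> ennreal r" if "e < r" for r
  proof -
    have ball: "mball_of Z u r = {v. u \<in> S \<and> v \<in> S \<and> d u v < r}" for u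
      using Z by auto
    have "\<exists>b\<in>mspace B. c a b < r" if "a \<in> mspace A" for a
    proof -
      obtain b where "(a, b) \<in> R" using correspondence_total(1)[OF R \<open>a \<in> mspace A\<close>] by blast
      then show ?thesis using c_le[of a b] \<open>e < r\<close> correspondence_in_space[OF R] by force
    qed
    moreover have "\<exists>a\<in>mspace A. c a b < r" if "b \<in> mspace B" for b
    proof -
      obtain a where "(a, b) \<in> R" using correspondence_total(2)[OF R \<open>b \<in> mspace B\<close>] by blast
      then show ?thesis using c_le[of a b] \<open>e < r\<close> correspondence_in_space[OF R] by force
    qed
    ultimately have "Inl ` mspace A \<subseteq> (\<Union>v\<in>Inr ` mspace B. mball_of Z v r)"
      "Inr ` mspace B \<subseteq> (\<Union>u\<in>Inl ` mspace A. mball_of Z u r)"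
      unfolding ball S_def by auto
    moreover have "r > 0" using e that by simp
    ultimately show ?thesis
      unfolding hausdorff_dist_def by (intro Inf_lower CollectI exI[of _ r] conjI refl)
  qed
  then have le: "GH_dist A B \<le> ennreal r" if "e < r" for r
    using GH_dist_le[OF emb] that by (meson order_trans)
  show ?thesis
  proof (rule ennreal_le_epsilon)
    fix t :: real assume "t > 0"
    then show "GH_dist A B \<le> ennreal e + ennreal t"
      using le[of "e + t"] e by simp
  qed
qed

text \<open>The infimum over correspondences need not be attained, so the characterization of
  \<open>GH_dist A B \<le> r\<close> carries an arbitrarily small slack.\<close>

lemma GH_dist_leI:
  assumes "\<And>e. e > 0 \<Longrightarrow> \<exists>R. correspondence A B (r + e) R" and r: "r \<ge> 0"
  shows "GH_dist A B \<le> ennreal r"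
proof (rule ennreal_le_epsilon)
  fix e :: real assume "e > 0"
  with assms obtain R where "correspondence A B (r + e) R" by blast
  then have "GH_dist A B \<le> ennreal (r + e)"
    using r \<open>e > 0\<close> by (intro correspondence_imp_GH_dist_le) auto
  then show "GH_dist A B \<le> ennreal r + ennreal e"
    using r \<open>e > 0\<close> by simp
qed

lemma GH_dist_le_imp_correspondence:
  assumes "GH_dist A B \<le> ennreal r" "r \<ge> 0" "e > 0"
  shows "\<exists>R. correspondence A B (r + e) R"
proof (rule GH_dist_less_imp_correspondence)
  have "ennreal r < ennreal (r + e)" using assms by (simp add: ennreal_less_iff)
  with assms(1) show "GH_dist A B < ennreal (r + e)" by (rule le_less_trans)
qed

lemma GH_dist_commute: "GH_dist A B = GH_dist B A"
proof -
  have le: "GH_dist B A \<le> GH_dist A B" for A :: "'c metric" and B :: "'d metric"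
  proof (cases "GH_dist A B")
    case (real r)
    have "\<exists>R. correspondence B A (r + e) R" if "e > 0" for e
      using GH_dist_le_imp_correspondence[of A B r e] correspondence_converse[of A B "r + e"] real that
      by fastforce
    with real have "GH_dist B A \<le> ennreal r"
      by (intro GH_dist_leI)
    with real show ?thesis by simp
  qed simp
  show ?thesis by (intro antisym le)
qed

text \<open>Composing correspondences adds their distortions.\<close>

lemma GH_dist_triangle: "GH_dist A C \<le> GH_dist A B + GH_dist B C"
proof (cases "GH_dist A B"; cases "GH_dist B C")
  fix r s assume r: "0 \<le> r" "GH_dist A B = ennreal r" and s: "0 \<le> s" "GH_dist B C = ennreal s"
  have "\<exists>R. correspondence A C (r + s + e) R" if e: "e > 0" for e
  proof -
    obtain R where R: "correspondence A B (r + e/2) R"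
      using GH_dist_le_imp_correspondence[of A B r "e/2"] r e by auto
    obtain S where S: "correspondence B C (s + e/2) S"
      using GH_dist_le_imp_correspondence[of B C s "e/2"] s e by auto
    have "correspondence A C (r + s + e) (R O S)"
      by (rule correspondence_mono[OF correspondence_comp[OF R S]]) simp
    then show ?thesis by blast
  qed
  then have "GH_dist A C \<le> ennreal (r + s)"
    using r(1) s(1) by (intro GH_dist_leI) auto
  then show ?thesis using r s by simp
qed (auto simp: top_add add_top)

text \<open>Density gives correspondences of arbitrarily small distortion: a point of the completion is
  related to the points of \<open>A\<close> whose images are close to it.\<close>

lemma GH_dist_completion: "GH_dist (mcompletion A) A = 0"
proof -
  let ?N = "mcompletion A" and ?f = "to_completion A"
  interpret N: Metric_space "mspace ?N" "mdist ?N" by simp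
  have emb: "isometric_embedding A ?N ?f"
    and dense: "mtopology_of ?N closure_of (?f ` mspace A) = mspace ?N"
    using is_completion_mcompletion[of A] by (auto simp: is_completion_def)
  have in_N: "?f a \<in> mspace ?N" if "a \<in> mspace A" for a
    using emb that by (auto simp: isometric_embedding_def)
  have "\<exists>R. correspondence ?N A (0 + e) R" if "e > 0" for e
  proof -
    define R where "R = {(n, a). n \<in> mspace ?N \<and> a \<in> mspace A \<and> mdist ?N n (?f a) < e}"
    have "\<exists>a\<in>mspace A. mdist ?N n (?f a) < e" if "n \<in> mspace ?N" for n
    proof -
      have "n \<in> N.mtopology closure_of (?f ` mspace A)"
        using dense that by (simp add: mtopology_of_def)
      then show ?thesis
        using \<open>e > 0\<close> by (force simp: N.metric_closure_of)
    qed
    then have "Domain R = mspace ?N" by (auto simp: R_def)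
    moreover have "Range R = mspace A"
    proof -
      have "(?f a, a) \<in> R" if "a \<in> mspace A" for a
        using that in_N \<open>e > 0\<close> by (auto simp: R_def)
      then show ?thesis by (auto simp: R_def)
    qed
    moreover have "\<bar>mdist ?N n n' - mdist A a a'\<bar> \<le> 2 * e" if "(n, a) \<in> R" "(n', a') \<in> R" for n a n' a'
    proof -
      have in_sp: "n \<in> mspace ?N" "n' \<in> mspace ?N" "?f a \<in> mspace ?N" "?f a' \<in> mspace ?N"
        and lt: "mdist ?N n (?f a) < e" "mdist ?N n' (?f a') < e"
        and eq: "mdist A a a' = mdist ?N (?f a) (?f a')"
        using that in_N emb by (auto simp: R_def isometric_embedding_def)
      show ?thesis unfolding eq
        using N.triangle[of n "?f a" n'] N.triangle[of "?f a" "?f a'" n'] N.commute[of n' "?f a'"]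
          N.triangle[of "?f a" n "?f a'"] N.triangle[of n n' "?f a'"] N.commute[of n "?f a"] in_sp lt
        by linarith
    qed
    ultimately show ?thesis
      unfolding correspondence_def by (intro exI[of _ R]) simp
  qed
  then have "GH_dist ?N A \<le> ennreal 0" by (intro GH_dist_leI) auto
  then show ?thesis by simp
qed

text \<open>A space \<open>A\<close> inside \<open>N\<close> inherits a correspondence with its image under \<open>R\<close>; if that image is
  within Hausdorff distance \<open>d\<close> of \<open>Y\<close>, moving its points to \<open>Y\<close> changes distances by at most
  \<open>2 * d\<close>.\<close>

lemma correspondence_restrict_thicken:
  assumes R: "correspondence N X e R" and f: "isometric_embedding A N f"
    and Y: "Y \<subseteq> mspace X"
    and near: "\<And>s. s \<in> R `` (f ` mspace A) \<Longrightarrow> \<exists>y\<in>Y. mdist X s y < d"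
    and near': "\<And>y. y \<in> Y \<Longrightarrow> \<exists>s\<in>R `` (f ` mspace A). mdist X s y < d"
  shows "correspondence A (submetric X Y) (e + d)
    {(a, y). a \<in> mspace A \<and> y \<in> Y \<and> (\<exists>s. (f a, s) \<in> R \<and> mdist X s y < d)}" (is "correspondence _ _ _ ?Q")
  unfolding correspondence_def
proof (intro conjI allI impI)
  interpret X: Metric_space "mspace X" "mdist X" by simp
  have "\<exists>y. (a, y) \<in> ?Q" if a: "a \<in> mspace A" for a
  proof -
    have "f a \<in> mspace N" using f a by (auto simp: isometric_embedding_def)
    then obtain s where s: "(f a, s) \<in> R" using correspondence_total(1)[OF R] by blast
    then obtain y where "y \<in> Y" "mdist X s y < d" using near a by blast
    with s a show ?thesis by blast
  qed
  then show "Domain ?Q = mspace A" by auto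
  have sub: "mspace (submetric X Y) = Y" using Y by auto
  show "Range ?Q = mspace (submetric X Y)"
    unfolding sub using near' by fastforce
  fix a y a' y'
  assume "(a, y) \<in> ?Q" "(a', y') \<in> ?Q"
  then obtain s s' where *: "a \<in> mspace A" "y \<in> Y" "(f a, s) \<in> R" "mdist X s y < d"
    "a' \<in> mspace A" "y' \<in> Y" "(f a', s') \<in> R" "mdist X s' y' < d" by blast
  have sp: "s \<in> mspace X" "s' \<in> mspace X" "y \<in> mspace X" "y' \<in> mspace X"
    using * Y correspondence_in_space[OF R] by auto
  have "mdist N (f a) (f a') = mdist A a a'"
    using f * by (auto simp: isometric_embedding_def)
  then have "\<bar>mdist A a a' - mdist X s s'\<bar> \<le> 2 * e"
    using correspondence_distortion[OF R *(3) *(7)] by simp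
  moreover have "\<bar>mdist X s s' - mdist X y y'\<bar> \<le> 2 * d"
    using X.triangle[of s y s'] X.triangle[of y y' s'] X.triangle[of y s y'] X.triangle[of s s' y']
      X.commute[of y' s'] X.commute[of y s] sp *(4,8) by linarith
  ultimately show "\<bar>mdist A a a' - mdist (submetric X Y) y y'\<bar> \<le> 2 * (e + d)"
    by (simp add: abs_le_iff)
qed

text \<open>One sequence of correspondences serves all error bounds, so that the limit sets built from it
  for different parameters \<open>\<delta>\<close> are comparable as subsets of \<open>X\<close>.\<close>

lemma GH_converges_correspondences:
  assumes "GH_converges N X"
  obtains R where "\<And>e. e > 0 \<Longrightarrow> \<forall>\<^sub>F k in sequentially. correspondence (N k) X e (R k)"
proof -
  \<comment> \<open>The summand \<open>1/(k+1)\<close> turns the distance into a strict upper bound.\<close>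
  define r where "r k = enn2real (GH_dist (N k) X) + inverse (real (Suc k))" for k
  have lim: "(\<lambda>k. GH_dist (N k) X) \<longlonglongrightarrow> 0" using assms by (simp add: GH_converges_def)
  have "(\<lambda>k. enn2real (GH_dist (N k) X)) \<longlonglongrightarrow> enn2real 0"
    using tendsto_enn2real[where l = 0] lim by simp
  then have r: "r \<longlonglongrightarrow> 0"
    unfolding r_def using tendsto_add[OF _ LIMSEQ_inverse_real_of_nat] by fastforce
  have "\<exists>R. GH_dist (N k) X < top \<longrightarrow> correspondence (N k) X (r k) R" for k
  proof (cases "GH_dist (N k) X")
    case (real t)
    then have "GH_dist (N k) X < ennreal (r k)"
      by (auto simp: r_def ennreal_less_iff)
    then show ?thesis using GH_dist_less_imp_correspondence by blast
  qed auto
  then obtain R where R: "\<And>k. GH_dist (N k) X < top \<Longrightarrow> correspondence (N k) X (r k) (R k)"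
    by metis
  have "\<forall>\<^sub>F k in sequentially. correspondence (N k) X e (R k)" if "e > 0" for e
  proof -
    have "\<forall>\<^sub>F k in sequentially. GH_dist (N k) X < top"
      using lim by (rule order_tendstoD) simp
    moreover have "\<forall>\<^sub>F k in sequentially. r k < e"
      using r that by (rule order_tendstoD)
    ultimately show ?thesis
      by eventually_elim (rule correspondence_mono[OF R], auto)
  qed
  with that show ?thesis by blast
qed

text \<open>The limits \<open>L\<close> and \<open>L'\<close> are at Gromov-Hausdorff distance \<open>0\<close>, since the terms of \<open>S\<close> come
  arbitrarily close to both.\<close>

lemma GH_converges_if_subconverges:
  assumes conv: "GH_converges S L" and U: "U \<noteq> bot" "U \<le> sequentially"
    and lim: "((\<lambda>k. GH_dist (S k) L') \<longlongrightarrow> 0) U"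
  shows "GH_converges S L'"
proof -
  have lim1: "(\<lambda>k. GH_dist (S k) L) \<longlonglongrightarrow> 0" using conv by (simp add: GH_converges_def)
  then have "((\<lambda>k. GH_dist (S k) L) \<longlongrightarrow> 0) U" using U(2) by (rule tendsto_mono[rotated])
  from tendsto_add[OF this lim]
  have "((\<lambda>k. GH_dist (S k) L + GH_dist (S k) L') \<longlongrightarrow> 0) U" by simp
  moreover have "\<forall>\<^sub>F k in U. GH_dist L L' \<le> GH_dist (S k) L + GH_dist (S k) L'"
    using GH_dist_triangle[of L L' "S _"] by (simp add: GH_dist_commute[of L])
  ultimately have "GH_dist L L' \<le> 0"
    using U(1) tendsto_lowerbound by blast
  then have "GH_dist (S k) L' \<le> GH_dist (S k) L" for k
    using GH_dist_triangle[of "S k" L' L] by simp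
  then show ?thesis unfolding GH_converges_def
    by (intro tendsto_sandwich[OF _ _ tendsto_const lim1]) auto
qed

section \<open>Inner regions\<close>

text \<open>Besides the Lipschitz estimate for the distance to the boundary, this contains that a point \<open>p\<close>
  of the completion near a point far from the boundary is itself a point of \<open>M\<close>: otherwise \<open>p\<close>
  would be a boundary point that is too close.\<close>

lemma boundary_dist_Lipschitz:
  assumes x: "x \<in> mspace M" and far: "boundary_dist M x > ennreal \<delta>"
    and p: "p \<in> mspace (mcompletion M)"
    and near: "mdist (mcompletion M) p (to_completion M x) < r"
    and sum: "\<delta>' + r \<le> \<delta>" "0 \<le> \<delta>'"
  obtains y where "y \<in> mspace M" "p = to_completion M y" "boundary_dist M y > ennreal \<delta>'"
proof -
  let ?N = "mcompletion M" and ?f = "to_completion M"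
  interpret N: Metric_space "mspace ?N" "mdist ?N" by simp
  have fx: "?f x \<in> mspace ?N"
    using is_completion_mcompletion[of M] x by (auto simp: is_completion_def isometric_embedding_def)
  have bd: "\<delta> < mdist ?N (?f x) q" if "q \<in> mboundary M" for q
  proof -
    have "boundary_dist M x \<le> ennreal (mdist ?N (?f x) q)"
      unfolding boundary_dist_def using that by (rule INF_lower)
    with far have "ennreal \<delta> < ennreal (mdist ?N (?f x) q)" by (rule less_le_trans)
    then show ?thesis by (meson ennreal_leI leD leI)
  qed
  have "p \<notin> mboundary M"
  proof
    assume "p \<in> mboundary M"
    then have "\<delta> < mdist ?N (?f x) p" by (rule bd)
    then show False using near sum by (simp add: N.commute)
  qed
  then obtain y where y: "y \<in> mspace M" "p = ?f y"
    using p by (auto simp: mboundary_def)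
  have lower: "\<delta> - mdist ?N p (?f x) \<le> mdist ?N p q" if "q \<in> mboundary M" for q
    using bd[OF that] N.triangle[of "?f x" p q] fx p that by (auto simp: mboundary_def N.commute)
  have "ennreal \<delta>' < ennreal (\<delta> - mdist ?N p (?f x))"
    using near sum by (simp add: ennreal_less_iff)
  also have "\<dots> \<le> boundary_dist M y"
    unfolding boundary_dist_def using lower y by (auto intro!: INF_greatest ennreal_leI)
  finally show ?thesis using that y by blast
qed


lemma isometric_embedding_inner_region:
  "isometric_embedding (inner_region M \<delta>) (mcompletion M) (to_completion M)"
  using is_completion_mcompletion[of M]
  by (auto simp: is_completion_def isometric_embedding_def inner_region_def)

lemma mspace_inner_region:
  "mspace (inner_region M \<delta>) = {x \<in> mspace M. boundary_dist M x > ennreal \<delta>}"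
  by (auto simp: inner_region_def)

section \<open>Limits of sets along an ultrafilter\<close>

text \<open>The Kuratowski lower limit of the family \<open>S\<close> along \<open>U\<close>. For an ultrafilter it agrees with the
  upper limit.\<close>

definition limit_set :: "'i filter \<Rightarrow> 'b metric \<Rightarrow> ('i \<Rightarrow> 'b set) \<Rightarrow> 'b set" where
  "limit_set U X S = {y \<in> mspace X. \<forall>e>0. \<forall>\<^sub>F k in U. \<exists>s\<in>S k. mdist X s y < e}"

lemma limit_setD:
  assumes "y \<in> limit_set U X S" "e > 0"
  shows "\<forall>\<^sub>F k in U. \<exists>s\<in>S k. mdist X s y < e"
  using assms by (auto simp: limit_set_def)

lemma limit_set_mono:
  assumes "\<And>k. S k \<subseteq> T k"
  shows "limit_set U X S \<subseteq> limit_set U X T"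
  unfolding limit_set_def using assms by (fastforce elim: eventually_mono)

lemma closedin_limit_set:
  assumes S: "\<And>k. S k \<subseteq> mspace X"
  shows "closedin (mtopology_of X) (limit_set U X S)"
proof -
  interpret X: Metric_space "mspace X" "mdist X" by simp
  have "\<exists>r>0. disjnt (limit_set U X S) (X.mball z r)"
    if z: "z \<in> mspace X" "z \<notin> limit_set U X S" for z
  proof -
    obtain e where e: "e > 0" "\<not> (\<forall>\<^sub>F k in U. \<exists>s\<in>S k. mdist X s z < e)"
      using z by (auto simp: limit_set_def)
    have "y \<notin> limit_set U X S" if y: "y \<in> X.mball z (e/2)" for y
    proof
      assume "y \<in> limit_set U X S"
      then have "\<forall>\<^sub>F k in U. \<exists>s\<in>S k. mdist X s y < e/2"
        using e(1) by (intro limit_setD) auto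
      then have "\<forall>\<^sub>F k in U. \<exists>s\<in>S k. mdist X s z < e"
      proof eventually_elim
        case (elim k)
        then obtain s where s: "s \<in> S k" "mdist X s y < e/2" by blast
        have "mdist X s z < e"
          using X.triangle[of s y z] X.commute[of y z] s y S[of k] by (auto simp: subset_iff)
        with s show ?case by blast
      qed
      with e(2) show False by blast
    qed
    then show ?thesis using e(1) by (intro exI[of _ "e/2"]) (auto simp: disjnt_iff)
  qed
  then show ?thesis
    unfolding mtopology_of_def X.closedin_metric by (auto simp: limit_set_def)
qed

lemma ultrafilter_limit_metric:
  assumes U: "is_ultrafilter U" and X: "compact_space (mtopology_of X)"
    and f: "\<forall>\<^sub>F k in U. f k \<in> mspace X"
  shows "\<exists>l\<in>mspace X. \<forall>e>0. \<forall>\<^sub>F k in U. mdist X (f k) l < e"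
proof -
  interpret X: Metric_space "mspace X" "mdist X" by simp
  from compact_space_ultrafilter_limit[OF U X, of f] f obtain l where l: "limitin X.mtopology f l U"
    by (auto simp: mtopology_of_def)
  then have "l \<in> mspace X" "\<forall>e>0. \<forall>\<^sub>F k in U. f k \<in> mspace X \<and> mdist X (f k) l < e"
    unfolding X.limitin_metric by auto
  then show ?thesis by (intro bexI[of _ l]) (auto elim: eventually_mono)
qed

text \<open>This and the next lemma say that \<open>S\<close> converges to its limit set in the Hausdorff sense. Here,
  points of \<open>S k\<close> that stay away from the limit set would have a limit along \<open>U\<close>, which belongs to
  the limit set by definition.\<close>

lemma eventually_near_limit_set:
  assumes U: "is_ultrafilter U" and X: "compact_space (mtopology_of X)"
    and S: "\<And>k. S k \<subseteq> mspace X" and e: "e > 0"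
  shows "\<forall>\<^sub>F k in U. \<forall>s\<in>S k. \<exists>y\<in>limit_set U X S. mdist X s y < e"
proof (rule ccontr)
  assume "\<not> ?thesis"
  then have "\<forall>\<^sub>F k in U. \<exists>s. s \<in> S k \<and> (\<forall>y\<in>limit_set U X S. \<not> mdist X s y < e)"
    by (auto dest!: ultrafilter_not_eventually[OF U] elim!: eventually_mono)
  then obtain f where f: "\<forall>\<^sub>F k in U. f k \<in> S k \<and> (\<forall>y\<in>limit_set U X S. \<not> mdist X (f k) y < e)"
    unfolding eventually_ex by blast
  then have "\<forall>\<^sub>F k in U. f k \<in> mspace X"
    by eventually_elim (use S in blast)
  then obtain l where l: "l \<in> mspace X" "\<And>e. e > 0 \<Longrightarrow> \<forall>\<^sub>F k in U. mdist X (f k) l < e"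
    using ultrafilter_limit_metric[OF U X] by blast
  have "\<forall>\<^sub>F k in U. \<exists>s\<in>S k. mdist X s l < d" if "d > 0" for d
    using l(2)[OF that] f by eventually_elim blast
  then have "l \<in> limit_set U X S" using l(1) by (simp add: limit_set_def)
  then have "\<forall>\<^sub>F k in U. False"
    using f l(2)[OF e] by (auto elim: eventually_elim2)
  then show False using U by (simp add: is_ultrafilter_def)
qed

text \<open>Each single point of the limit set is eventually close to \<open>S k\<close>. To get this uniformly, points
  of the limit set that stay away from \<open>S k\<close> are replaced by their limit along \<open>U\<close>, which lies in
  the limit set since that set is closed.\<close>

lemma eventually_limit_set_near:
  assumes U: "is_ultrafilter U" and X: "compact_space (mtopology_of X)"
    and S: "\<And>k. S k \<subseteq> mspace X" and e: "e > 0"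
  shows "\<forall>\<^sub>F k in U. \<forall>y\<in>limit_set U X S. \<exists>s\<in>S k. mdist X s y < e"
proof (rule ccontr)
  interpret X: Metric_space "mspace X" "mdist X" by simp
  assume "\<not> ?thesis"
  then have "\<forall>\<^sub>F k in U. \<exists>y. y \<in> limit_set U X S \<and> (\<forall>s\<in>S k. \<not> mdist X s y < e)"
    by (auto dest!: ultrafilter_not_eventually[OF U] elim!: eventually_mono)
  then obtain f where f: "\<forall>\<^sub>F k in U. f k \<in> limit_set U X S \<and> (\<forall>s\<in>S k. \<not> mdist X s (f k) < e)"
    unfolding eventually_ex by blast
  then have fX: "\<forall>\<^sub>F k in U. f k \<in> mspace X"
    by eventually_elim (simp add: limit_set_def)
  then obtain l where l: "l \<in> mspace X" "\<And>e. e > 0 \<Longrightarrow> \<forall>\<^sub>F k in U. mdist X (f k) l < e"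
    using ultrafilter_limit_metric[OF U X] by blast
  have closed: "closedin X.mtopology (limit_set U X S)"
    using closedin_limit_set[of S X U] S by (simp add: mtopology_of_def)
  have "limitin X.mtopology f l U"
    unfolding X.limitin_metric using l fX by (auto intro: eventually_conj)
  moreover have "\<forall>\<^sub>F k in U. f k \<in> limit_set U X S"
    using f by eventually_elim blast
  ultimately have "l \<in> limit_set U X S"
    using U closed by (auto simp: is_ultrafilter_def intro: limitin_closedin)
  then have "\<forall>\<^sub>F k in U. \<exists>s\<in>S k. mdist X s l < e/2"
    using e by (intro limit_setD) auto
  moreover have "\<forall>\<^sub>F k in U. mdist X (f k) l < e/2"
    using e by (intro l(2)) simp
  ultimately have "\<forall>\<^sub>F k in U. False"
    using f fX
  proof eventually_elim
    case (elim k)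
    then obtain s where s: "s \<in> S k" "mdist X s l < e/2" by blast
    have "mdist X s (f k) < e"
      using X.triangle[of s l "f k"] X.commute[of l "f k"] s elim(2,4) l(1) S[of k]
      by (auto simp: subset_iff)
    with s(1) elim(3) show ?case by blast
  qed
  then show False using U by (simp add: is_ultrafilter_def)
qed

section \<open>Limits of the inner regions\<close>

text \<open>The last property is the quantitative form of openness:
  \<open>\<delta>/2\<close> plus the vanishing errors stays below \<open>3\<delta>/4\<close>, which leaves \<open>\<delta>/4\<close> of the distance to the
  boundary.\<close>

lemma inner_limits_along_ultrafilter:
  fixes M :: "nat \<Rightarrow> 'a metric" and X :: "'b metric"
  assumes X: "compact_space (mtopology_of X)" and conv: "GH_converges (\<lambda>k. mcompletion (M k)) X"
    and U: "is_ultrafilter U" "U \<le> sequentially"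
  obtains Y where "\<And>\<delta>. compactin (mtopology_of X) (Y \<delta>)"
    and "\<And>\<delta>. ((\<lambda>k. GH_dist (mcompletion (inner_region (M k) \<delta>)) (submetric X (Y \<delta>))) \<longlongrightarrow> 0) U"
    and "\<And>\<delta> \<delta>'. \<delta>' \<le> \<delta> \<Longrightarrow> Y \<delta> \<subseteq> Y \<delta>'"
    and "\<And>\<delta> y. \<lbrakk>\<delta> > 0; y \<in> Y \<delta>\<rbrakk> \<Longrightarrow> mball_of X y (\<delta> / 2) \<subseteq> Y (\<delta> / 4)"
proof -
  interpret X: Metric_space "mspace X" "mdist X" by simp
  obtain R0 where R0: "\<And>e. e > 0 \<Longrightarrow> \<forall>\<^sub>F k in sequentially. correspondence (mcompletion (M k)) X e (R0 k)"
    using GH_converges_correspondences[OF conv] by blast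
  \<comment> \<open>For finitely many \<open>k\<close> the relation \<open>R0 k\<close> may fail to be a correspondence; cutting
    it down to \<open>X\<close> keeps all the sets below inside \<open>X\<close>.\<close>
  define R where "R k = R0 k \<inter> UNIV \<times> mspace X" for k
  have R: "\<forall>\<^sub>F k in U. correspondence (mcompletion (M k)) X e (R k)" if "e > 0" for e
  proof -
    have "\<forall>\<^sub>F k in U. correspondence (mcompletion (M k)) X e (R0 k)"
      using R0[OF that] U(2) by (rule filter_leD[rotated])
    then show ?thesis
    proof eventually_elim
      case (elim k)
      then have "R k = R0 k" by (auto simp: R_def dest: correspondence_in_space)
      with elim show ?case by simp
    qed
  qed
  define S where "S \<delta> k = R k `` (to_completion (M k) ` mspace (inner_region (M k) \<delta>))" for \<delta> k
  define Y where "Y \<delta> = limit_set U X (S \<delta>)" for \<delta>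
  have SX: "S \<delta> k \<subseteq> mspace X" for \<delta> k by (auto simp: S_def R_def)
  have YX: "Y \<delta> \<subseteq> mspace X" for \<delta> by (auto simp: Y_def limit_set_def)
  show thesis
  proof (rule that)
    show "compactin (mtopology_of X) (Y \<delta>)" for \<delta>
      unfolding Y_def by (intro closedin_compact_space X closedin_limit_set SX)
    show "Y \<delta> \<subseteq> Y \<delta>'" if "\<delta>' \<le> \<delta>" for \<delta> \<delta>'
    proof -
      have "mspace (inner_region (M k) \<delta>) \<subseteq> mspace (inner_region (M k) \<delta>')" for k
        using ennreal_leI[OF that] by (auto simp: mspace_inner_region)
      then show ?thesis unfolding Y_def S_def by (intro limit_set_mono Image_mono image_mono order_refl)
    qed
    show "((\<lambda>k. GH_dist (mcompletion (inner_region (M k) \<delta>)) (submetric X (Y \<delta>))) \<longlongrightarrow> 0) U" for \<delta>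
    proof -
      have "\<forall>\<^sub>F k in U. GH_dist (mcompletion (inner_region (M k) \<delta>)) (submetric X (Y \<delta>)) \<le> ennreal e"
        if e: "e > 0" for e
      proof -
        have e2: "e/2 > 0" using e by simp
        have "\<forall>\<^sub>F k in U. \<forall>s\<in>S \<delta> k. \<exists>y\<in>Y \<delta>. mdist X s y < e/2"
          unfolding Y_def by (rule eventually_near_limit_set[OF U(1) X SX e2])
        moreover have "\<forall>\<^sub>F k in U. \<forall>y\<in>Y \<delta>. \<exists>s\<in>S \<delta> k. mdist X s y < e/2"
          unfolding Y_def by (rule eventually_limit_set_near[OF U(1) X SX e2])
        ultimately show ?thesis using R[OF e2]
        proof eventually_elim
          case (elim k)
          have "correspondence (inner_region (M k) \<delta>) (submetric X (Y \<delta>)) (e/2 + e/2)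
            {(a, y). a \<in> mspace (inner_region (M k) \<delta>) \<and> y \<in> Y \<delta> \<and>
              (\<exists>s. (to_completion (M k) a, s) \<in> R k \<and> mdist X s y < e/2)}"
            using elim(1,2) unfolding S_def
            by (intro correspondence_restrict_thicken[OF elim(3) isometric_embedding_inner_region YX]) blast+
          then have "GH_dist (inner_region (M k) \<delta>) (submetric X (Y \<delta>)) \<le> ennreal e"
            using correspondence_imp_GH_dist_le e by fastforce
          then show ?case
            using GH_dist_triangle[of "mcompletion (inner_region (M k) \<delta>)" "submetric X (Y \<delta>)" "inner_region (M k) \<delta>"]
            by (simp add: GH_dist_completion)
        qed
      qed
      note small = this
      show ?thesis
      proof (rule order_tendstoI)
        fix a :: ennreal assume "0 < a"
        then obtain b where b: "0 < b" "b < a" using dense by blast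
        then obtain e where "e > 0" "ennreal e < a" by (cases b) auto
        then show "\<forall>\<^sub>F k in U. GH_dist (mcompletion (inner_region (M k) \<delta>)) (submetric X (Y \<delta>)) < a"
          using small[of e] by (auto elim!: eventually_mono)
      qed simp
    qed
    show "mball_of X y (\<delta> / 2) \<subseteq> Y (\<delta> / 4)" if \<delta>: "\<delta> > 0" and y: "y \<in> Y \<delta>" for \<delta> y
    proof
      fix z assume "z \<in> mball_of X y (\<delta> / 2)"
      then have z: "z \<in> mspace X" "mdist X y z < \<delta>/2" by auto
      have "\<forall>\<^sub>F k in U. \<exists>s\<in>S \<delta> k. mdist X s y < \<delta>/8"
        using limit_setD[OF y[unfolded Y_def], of "\<delta>/8"] \<delta> by simp
      moreover have "\<forall>\<^sub>F k in U. correspondence (mcompletion (M k)) X (\<delta>/16) (R k)"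
        using R \<delta> by simp
      \<comment> \<open>It is \<open>z\<close> itself, not merely a nearby point, that belongs to the sets \<open>S (\<delta>/4) k\<close>, since
        the range of \<open>R k\<close> is all of \<open>X\<close>.\<close>
      ultimately have ev: "\<forall>\<^sub>F k in U. z \<in> S (\<delta>/4) k"
      proof eventually_elim
        case (elim k)
        then obtain x s where x: "x \<in> mspace (inner_region (M k) \<delta>)"
          and xs: "(to_completion (M k) x, s) \<in> R k" and sy: "mdist X s y < \<delta>/8"
          by (auto simp: S_def)
        obtain p where p: "(p, z) \<in> R k"
          using correspondence_total(2)[OF elim(2) z(1)] by blast
        have "\<bar>mdist (mcompletion (M k)) p (to_completion (M k) x) - mdist X z s\<bar> \<le> 2 * (\<delta>/16)"
          by (rule correspondence_distortion[OF elim(2) p xs])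
        moreover have "mdist X z s \<le> mdist X z y + mdist X y s"
          using z(1) y YX correspondence_in_space(2)[OF elim(2) xs] by (intro X.triangle) auto
        ultimately have "mdist (mcompletion (M k)) p (to_completion (M k) x) < 3 * \<delta>/4"
          using z(2) sy X.commute[of z y] X.commute[of s y] by linarith
        then obtain m where "m \<in> mspace (M k)" "p = to_completion (M k) m" "boundary_dist (M k) m > ennreal (\<delta>/4)"
          using boundary_dist_Lipschitz[of x "M k" \<delta> p "3*\<delta>/4" "\<delta>/4"] x \<delta>
            correspondence_in_space(1)[OF elim(2) p] by (auto simp: mspace_inner_region)
        then show ?case using p by (auto simp: S_def mspace_inner_region)
      qed
      have "\<forall>\<^sub>F k in U. \<exists>s\<in>S (\<delta>/4) k. mdist X s z < e" if "e > 0" for e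
        using ev by eventually_elim (use z(1) that in \<open>auto intro!: bexI[of _ z]\<close>)
      then show "z \<in> Y (\<delta>/4)" using z(1) by (simp add: Y_def limit_set_def)
    qed
  qed
qed

text \<open>Any property that holds eventually along \<open>U\<close> holds for infinitely many indices, in particular
  smallness of the first \<open>n\<close> of the functions \<open>h\<close>.\<close>

lemma diagonal_subsequence_of_ultralimits:
  fixes h :: "nat \<Rightarrow> nat \<Rightarrow> ennreal"
  assumes U: "U \<noteq> bot" "U \<le> sequentially" and lim: "\<And>i. (h i \<longlongrightarrow> 0) U"
  obtains j where "strict_mono j" "\<And>i. (\<lambda>k. h i (j k)) \<longlonglongrightarrow> 0"
proof -
  have ex: "\<exists>k>m. \<forall>i\<le>n. h i k < ennreal (inverse (Suc n))" for m n
  proof -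
    have "\<forall>\<^sub>F k in U. \<forall>i\<in>{..n}. h i k < ennreal (inverse (Suc n))"
      using lim by (intro eventually_ball_finite ballI order_tendstoD(2)[of "h _"]) auto
    moreover have "\<forall>\<^sub>F k in U. k > m"
      using eventually_gt_at_top U(2) by (rule filter_leD[rotated])
    ultimately have "\<forall>\<^sub>F k in U. m < k \<and> (\<forall>i\<le>n. h i k < ennreal (inverse (Suc n)))"
      by eventually_elim auto
    then show ?thesis using U(1) eventually_happens by blast
  qed
  have "\<exists>j. \<forall>n. (\<forall>i\<le>n. h i (j n) < ennreal (inverse (Suc n))) \<and> j n < j (Suc n)"
    using ex by (intro dependent_nat_choice) blast+
  then obtain j where j: "\<And>n i. i \<le> n \<Longrightarrow> h i (j n) < ennreal (inverse (Suc n))" "\<And>n. j n < j (Suc n)"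
    by blast
  show thesis
  proof
    show "strict_mono j" using j(2) by (simp add: strict_mono_Suc_iff)
    show "(\<lambda>k. h i (j k)) \<longlonglongrightarrow> 0" for i
    proof (rule tendsto_sandwich[OF _ _ tendsto_const])
      show "\<forall>\<^sub>F k in sequentially. h i (j k) \<le> ennreal (inverse (Suc k))"
        using eventually_ge_at_top[of i] by eventually_elim (use j(1) in \<open>auto intro: less_imp_le\<close>)
      show "(\<lambda>k. ennreal (inverse (Suc k))) \<longlonglongrightarrow> 0"
        using tendsto_ennrealI[OF LIMSEQ_inverse_real_of_nat] by simp
    qed simp
  qed
qed

theorem theorem4p1:
  fixes M :: "nat \<Rightarrow> 'a metric" and X :: "'b metric"
  assumes "\<And>j. precompact_metric (M j)"
    and "\<And>j. open_metric (M j)"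
    and "compact_space (mtopology_of X)"
    and "GH_converges (\<lambda>j. mcompletion (M j)) X"
  shows
    "(\<forall>\<delta>>0. \<exists>j. strict_mono j \<and> (\<exists>Y. inner_limit M X j \<delta> Y)) \<and>
     (\<forall>\<delta>. positive_null_seq \<delta> \<longrightarrow>
        (\<exists>j. strict_mono j \<and> (\<forall>i. \<exists>Y. inner_limit M X j (\<delta> i) Y))) \<and>
     (\<forall>j. strict_mono j \<longrightarrow>
        (\<exists>Y :: real \<Rightarrow> 'b set.
           (\<forall>\<delta>>0. has_inner_limit M X j \<delta> \<longrightarrow> inner_limit M X j \<delta> (Y \<delta>)) \<and>
           (\<forall>\<delta>1 \<delta>2. 0 < \<delta>2 \<and> \<delta>2 < \<delta>1 \<and> has_inner_limit M X j \<delta>1 \<and> has_inner_limit M X j \<delta>2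
              \<longrightarrow> Y \<delta>1 \<subseteq> Y \<delta>2) \<and>
           (\<forall>\<delta>. positive_null_seq \<delta> \<and> (\<forall>i. has_inner_limit M X j (\<delta> i))
              \<longrightarrow> openin (mtopology_of X) (\<Union>i. Y (\<delta> i))) \<and>
           (\<forall>\<delta> \<beta>. positive_null_seq \<delta> \<and> positive_null_seq \<beta> \<and>
              (\<forall>i. has_inner_limit M X j (\<delta> i)) \<and> (\<forall>i. has_inner_limit M X j (\<beta> i))
              \<longrightarrow> (\<Union>i. Y (\<delta> i)) = (\<Union>i. Y (\<beta> i)))))"
proof -
  note X = assms(3) and conv = assms(4)
  obtain U :: "nat filter" where U: "is_ultrafilter U" "U \<le> sequentially"
    using ex_ultrafilter_le[of sequentially] by auto
  have nontrivial: "U \<noteq> bot" using U(1) by (simp add: is_ultrafilter_def)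
  have subseq: "\<exists>j. strict_mono j \<and> (\<forall>i. \<exists>Y. inner_limit M X j (\<delta> i) Y)" for \<delta> :: "nat \<Rightarrow> real"
  proof -
    obtain Y where Y: "\<And>\<delta>. compactin (mtopology_of X) (Y \<delta>)"
      "\<And>\<delta>. ((\<lambda>k. GH_dist (mcompletion (inner_region (M k) \<delta>)) (submetric X (Y \<delta>))) \<longlongrightarrow> 0) U"
      by (rule inner_limits_along_ultrafilter[OF X conv U]) blast
    obtain j where "strict_mono j" "\<And>i. (\<lambda>k. GH_dist
        (mcompletion (inner_region (M (j k)) (\<delta> i))) (submetric X (Y (\<delta> i)))) \<longlonglongrightarrow> 0"
      by (rule diagonal_subsequence_of_ultralimits[OF nontrivial U(2), of "\<lambda>i k. GH_dist
        (mcompletion (inner_region (M k) (\<delta> i))) (submetric X (Y (\<delta> i)))"])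
        (use Y(2) in auto)
    with Y(1) show ?thesis unfolding inner_limit_def GH_converges_def by blast
  qed
  show ?thesis
  proof (intro conjI allI impI)
    show "\<exists>j. strict_mono j \<and> (\<exists>Y. inner_limit M X j \<delta> Y)" for \<delta>
      using subseq[of "\<lambda>_. \<delta>"] by simp
    show "\<exists>j. strict_mono j \<and> (\<forall>i. \<exists>Y. inner_limit M X j (\<delta> i) Y)"
      for \<delta> :: "nat \<Rightarrow> real"
      by (rule subseq)
  next
    fix j :: "nat \<Rightarrow> nat" assume j: "strict_mono j"
    have conv_j: "GH_converges (\<lambda>k. mcompletion (M (j k))) X"
      using LIMSEQ_subseq_LIMSEQ[OF conv[unfolded GH_converges_def] j]
      by (simp add: GH_converges_def o_def)
    obtain Y where Y_compact: "\<And>\<delta>. compactin (mtopology_of X) (Y \<delta>)"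
      and Y_lim: "\<And>\<delta>. ((\<lambda>k. GH_dist (mcompletion (inner_region (M (j k)) \<delta>)) (submetric X (Y \<delta>))) \<longlongrightarrow> 0) U"
      and Y_mono: "\<And>\<delta> \<delta>'. \<delta>' \<le> \<delta> \<Longrightarrow> Y \<delta> \<subseteq> Y \<delta>'"
      and Y_ball: "\<And>\<delta> y. \<lbrakk>\<delta> > 0; y \<in> Y \<delta>\<rbrakk> \<Longrightarrow> mball_of X y (\<delta> / 2) \<subseteq> Y (\<delta> / 4)"
      by (rule inner_limits_along_ultrafilter[OF X conv_j U]) blast
    have small: "\<exists>i. \<beta> i \<le> e" if "positive_null_seq \<beta>" "e > 0" for \<beta> e
    proof -
      have "\<forall>\<^sub>F i in sequentially. \<beta> i < e"
        using that by (intro order_tendstoD(2)[of \<beta> 0]) (simp_all add: positive_null_seq_def)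
      then obtain i where "\<beta> i < e"
        by (auto simp: eventually_sequentially)
      then show ?thesis by (intro exI[of _ i]) simp
    qed
    have limit: "inner_limit M X j \<delta> (Y \<delta>)" if "has_inner_limit M X j \<delta>" for \<delta>
      using that Y_compact GH_converges_if_subconverges[OF _ nontrivial U(2) Y_lim]
      by (auto simp: has_inner_limit_def inner_limit_def)
    have opn: "openin (mtopology_of X) (\<Union>i. Y (\<delta> i))" if \<delta>: "positive_null_seq \<delta>" for \<delta>
    proof -
      interpret X: Metric_space "mspace X" "mdist X" by simp
      have "\<exists>r>0. X.mball y r \<subseteq> (\<Union>i. Y (\<delta> i))" if y: "y \<in> Y (\<delta> i)" for y i
      proof -
        have pos: "\<delta> i > 0" using \<delta> by (simp add: positive_null_seq_def)
        obtain i' where "\<delta> i' \<le> \<delta> i / 4" using small[OF \<delta>, of "\<delta> i / 4"] pos by auto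
        then have "mball_of X y (\<delta> i / 2) \<subseteq> Y (\<delta> i')"
          using Y_ball[OF pos y] Y_mono by blast
        then show ?thesis using pos by (intro exI[of _ "\<delta> i / 2"]) (auto simp: mball_of_def)
      qed
      moreover have "Y d \<subseteq> mspace X" for d
        using compactin_subset_topspace[OF Y_compact] by simp
      ultimately show ?thesis
        unfolding mtopology_of_def X.openin_mtopology by blast
    qed
    have union_le: "(\<Union>i. Y (\<delta> i)) \<subseteq> (\<Union>i. Y (\<beta> i))"
      if \<delta>: "positive_null_seq \<delta>" and \<beta>: "positive_null_seq \<beta>" for \<delta> \<beta>
    proof (rule UN_least)
      fix i
      obtain i' where "\<beta> i' \<le> \<delta> i"
        using small[OF \<beta>, of "\<delta> i"] \<delta> by (auto simp: positive_null_seq_def)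
      then show "Y (\<delta> i) \<subseteq> (\<Union>i. Y (\<beta> i))" using Y_mono by blast
    qed
    show "\<exists>Y :: real \<Rightarrow> 'b set.
           (\<forall>\<delta>>0. has_inner_limit M X j \<delta> \<longrightarrow> inner_limit M X j \<delta> (Y \<delta>)) \<and>
           (\<forall>\<delta>1 \<delta>2. 0 < \<delta>2 \<and> \<delta>2 < \<delta>1 \<and> has_inner_limit M X j \<delta>1 \<and> has_inner_limit M X j \<delta>2
              \<longrightarrow> Y \<delta>1 \<subseteq> Y \<delta>2) \<and>
           (\<forall>\<delta>. positive_null_seq \<delta> \<and> (\<forall>i. has_inner_limit M X j (\<delta> i))
              \<longrightarrow> openin (mtopology_of X) (\<Union>i. Y (\<delta> i))) \<and>
           (\<forall>\<delta> \<beta>. positive_null_seq \<delta> \<and> positive_null_seq \<beta> \<and>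
              (\<forall>i. has_inner_limit M X j (\<delta> i)) \<and> (\<forall>i. has_inner_limit M X j (\<beta> i))
              \<longrightarrow> (\<Union>i. Y (\<delta> i)) = (\<Union>i. Y (\<beta> i)))"
    proof (intro exI[of _ Y] conjI allI impI)
      show "Y \<delta>1 \<subseteq> Y \<delta>2" if "0 < \<delta>2 \<and> \<delta>2 < \<delta>1 \<and> has_inner_limit M X j \<delta>1 \<and> has_inner_limit M X j \<delta>2"
        for \<delta>1 \<delta>2 using that Y_mono by simp
      show "(\<Union>i. Y (\<delta> i)) = (\<Union>i. Y (\<beta> i))"
        if "positive_null_seq \<delta> \<and> positive_null_seq \<beta> \<and>
          (\<forall>i. has_inner_limit M X j (\<delta> i)) \<and> (\<forall>i. has_inner_limit M X j (\<beta> i))" for \<delta> \<beta>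
        using that by (intro subset_antisym union_le) simp_all
    qed (use limit opn in simp_all)
  qed
qed

end
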